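(* Let $(W,S)$ be a finite Coxeter system and let $I,J\subset S$ with $I\sim_W J$. Then: (1) for any conjugacy class $C$ of $W$, $|X_I\cap C|=|X_J\cap C|$; (2) for any Coxeter class $\lambda\in\Lambda(W)$, $|X_I\cap C(\lambda)|=|X_J\cap C(\lambda)|$.
   Context: $\ell$ is the length function. For $I\subset S$, $W_I$ is the subgroup generated by $I$ and $X_I=\{w\in W:\ell(ws)>\ell(w)\ \forall s\in I\}$. $I\sim_W J$ means $wIw^{-1}=J$ for some $w\in W$; the equivalence classes of this relation on subsets of $S$ are called Coxeter classes and $\Lambda(W)$ is the set of them. A cuspidal class of a finite Coxeter group is a conjugacy class meeting no proper standard parabolic subgroup; an $I$-cuspidal class is a cuspidal class of $W_I$. With $C(w)$ the conjugacy class of $w$ in $W$, $w$ is an $I$-element if $C(w)\cap W_I$ is an $I$-cuspidal class; $w$ is a $\lambda$-element if it is an $I$-element for some $I\in\lambda$. $C(\lambda)$ is the set of $\lambda$-elements. *)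

theory Defs
  imports "HOL-Algebra.Algebra"
begin

definition word_prod :: "('a, 'b) monoid_scheme \<Rightarrow> 'a list \<Rightarrow> 'a" where
  "word_prod W ws = foldr (\<lambda>s w. s \<otimes>\<^bsub>W\<^esub> w) ws \<one>\<^bsub>W\<^esub>"

text \<open>
  The monoid congruence on words over \<open>S\<close> generated by the relations \<open>(st)\<^bsup>m(s,t)\<^esup> = 1\<close>, where
  \<open>m(s,t)\<close> is the order of \<open>st\<close> in \<open>W\<close>. The function \<^const>\<open>group.ord\<close> is \<open>0\<close> on elements of
  infinite order, so such a pair contributes only the void relation. For generators of order 2 the
  case \<open>s = t\<close> is the relation \<open>s\<^sup>2 = 1\<close>, hence no formal inverses are needed and the quotient
  of the free monoid by this congruence is the group with these generators and relations.
\<close>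

inductive coxeter_word_eq :: "('a, 'b) monoid_scheme \<Rightarrow> 'a set \<Rightarrow> 'a list \<Rightarrow> 'a list \<Rightarrow> bool"
  for W S where
  refl: "set us \<subseteq> S \<Longrightarrow> coxeter_word_eq W S us us"
| sym: "coxeter_word_eq W S us vs \<Longrightarrow> coxeter_word_eq W S vs us"
| trans: "coxeter_word_eq W S us vs \<Longrightarrow> coxeter_word_eq W S vs ws \<Longrightarrow> coxeter_word_eq W S us ws"
| relation: "set us \<subseteq> S \<Longrightarrow> set vs \<subseteq> S \<Longrightarrow> s \<in> S \<Longrightarrow> t \<in> S \<Longrightarrow>
    coxeter_word_eq W S
      (us @ concat (replicate (group.ord W (s \<otimes>\<^bsub>W\<^esub> t)) [s, t]) @ vs) (us @ vs)"

text \<open>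
  The axiom \<open>presentation\<close> says that the canonical map from the presented group onto \<open>W\<close> is
  injective; it is well defined by the choice of the exponents, and onto by \<open>generated\<close>.
\<close>

locale coxeter_system = group W for W :: "('a, 'b) monoid_scheme" (structure) +
  fixes S :: "'a set"
  assumes S_subset: "S \<subseteq> carrier W"
    and S_order: "s \<in> S \<Longrightarrow> ord s = 2"
    and generated: "generate W S = carrier W"
    and presentation: "set us \<subseteq> S \<Longrightarrow> set vs \<subseteq> S \<Longrightarrow> word_prod W us = word_prod W vs \<Longrightarrow>
          coxeter_word_eq W S us vs"

definition coxeter_length :: "('a, 'b) monoid_scheme \<Rightarrow> 'a set \<Rightarrow> 'a \<Rightarrow> nat" where
  "coxeter_length W S w = (LEAST n. \<exists>ws. set ws \<subseteq> S \<and> word_prod W ws = w \<and> length ws = n)"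

definition coset_reps :: "('a, 'b) monoid_scheme \<Rightarrow> 'a set \<Rightarrow> 'a set \<Rightarrow> 'a set" where
  "coset_reps W S I =
    {w \<in> carrier W. \<forall>s\<in>I. coxeter_length W S (w \<otimes>\<^bsub>W\<^esub> s) > coxeter_length W S w}"

definition coxeter_rel :: "('a, 'b) monoid_scheme \<Rightarrow> 'a set \<Rightarrow> ('a set \<times> 'a set) set" where
  "coxeter_rel W S = {(I, J). I \<subseteq> S \<and> J \<subseteq> S \<and>
    (\<exists>w\<in>carrier W. (\<lambda>x. w \<otimes>\<^bsub>W\<^esub> x \<otimes>\<^bsub>W\<^esub> inv\<^bsub>W\<^esub> w) ` I = J)}"

definition coxeter_classes :: "('a, 'b) monoid_scheme \<Rightarrow> 'a set \<Rightarrow> 'a set set set" where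
  "coxeter_classes W S = Pow S // coxeter_rel W S"

definition conj_action :: "('a, 'b) monoid_scheme \<Rightarrow> 'a \<Rightarrow> 'a \<Rightarrow> 'a" where
  "conj_action W g = (\<lambda>h\<in>carrier W. g \<otimes>\<^bsub>W\<^esub> h \<otimes>\<^bsub>W\<^esub> inv\<^bsub>W\<^esub> g)"

definition conj_class :: "('a, 'b) monoid_scheme \<Rightarrow> 'a \<Rightarrow> 'a set" where
  "conj_class W w = orbit W (conj_action W) w"

definition conj_classes :: "('a, 'b) monoid_scheme \<Rightarrow> 'a set set" where
  "conj_classes W = orbits W (carrier W) (conj_action W)"

definition cuspidal_class :: "('a, 'b) monoid_scheme \<Rightarrow> 'a set \<Rightarrow> 'a set \<Rightarrow> bool" where
  "cuspidal_class W S C \<longleftrightarrow> C \<in> conj_classes W \<and>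
    (\<forall>K. K \<subseteq> S \<and> generate W K \<noteq> carrier W \<longrightarrow> C \<inter> generate W K = {})"

definition parabolic :: "('a, 'b) monoid_scheme \<Rightarrow> 'a set \<Rightarrow> ('a, 'b) monoid_scheme" where
  "parabolic W I = W\<lparr>carrier := generate W I\<rparr>"

text \<open>Conjugacy below is that of the Coxeter system \<open>(W\<^sub>I, I)\<close>, not that of \<open>W\<close>.\<close>

definition I_cuspidal_class :: "('a, 'b) monoid_scheme \<Rightarrow> 'a set \<Rightarrow> 'a set \<Rightarrow> bool" where
  "I_cuspidal_class W I C \<longleftrightarrow> cuspidal_class (parabolic W I) I C"

definition I_element :: "('a, 'b) monoid_scheme \<Rightarrow> 'a set \<Rightarrow> 'a \<Rightarrow> bool" where
  "I_element W I w \<longleftrightarrow> w \<in> carrier W \<and> I_cuspidal_class W I (conj_class W w \<inter> generate W I)"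

definition class_elements :: "('a, 'b) monoid_scheme \<Rightarrow> 'a set set \<Rightarrow> 'a set" where
  "class_elements W \<Lambda> = {w. \<exists>I\<in>\<Lambda>. I_element W I w}"

end

theory Submission
  imports Defs
begin

text \<open>
  The elements of \<open>W\<close> are regarded as the chambers of the Coxeter complex, and the elements of
  \<open>inversions w\<close> as the walls (reflections) that separate the chamber \<open>w\<close> from the
  chamber \<open>\<one>\<close>. So \<open>separating c d\<close>, the symmetric difference of two inversion sets,
  is the set of walls between \<open>c\<close> and \<open>d\<close>; left translation by \<open>g\<close> conjugates it by \<open>g\<close>.
  A coset \<open>u W\<^sub>I\<close> is the set of chambers around a face of type \<open>I\<close>, and
  \<open>P = u W\<^sub>I u\<^sup>-\<^sup>1\<close> is the stabiliser of that face.

  The element \<open>c\<^sup>-\<^sup>1 g c\<close> lies in \<open>X\<^sub>I\<close> iff no wall in the stabiliser of the type \<open>I\<close> face of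
  the chamber \<open>g c\<close> separates \<open>c\<close> from \<open>g c\<close>; that is, iff \<open>g c\<close> is the projection of \<open>c\<close> to
  its own face of type \<open>I\<close>. Counting the \<open>c\<close> with this property in two ways gives, for the class
  \<open>C\<close> of \<open>g\<close> and its centraliser \<open>Z\<close>,
  \<open>|X\<^sub>I \<inter> C| |Z| |W\<^sub>I| = \<Sum>u\<in>W. |Fix u|\<close>, where \<open>Fix u\<close> consists of the fixed points of the map
  \<open>\<phi>\<close> that projects a chamber to the face \<open>u W\<^sub>I\<close> and then translates by \<open>g\<^sup>-\<^sup>1\<close>
  (\<open>sum_card_fixed_chambers\<close>, \<open>card_conjugators\<close>).

  The point is that \<open>|Fix u|\<close> depends only on \<open>g\<close> and on the stabiliser \<open>P\<close>, and not on
  which of the faces with stabiliser \<open>P\<close> is used (\<open>card_fixed_chambers\<close>). Projection to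
  a face keeps exactly those walls between two chambers that lie in \<open>P\<close>. Let \<open>Q\<close> be the largest
  subset of \<open>P\<close> stable under conjugation by \<open>g\<close>. The walls between two fixed points in the same
  region of the arrangement \<open>Q\<close> form a \<open>g\<close>-stable subset of \<open>P\<close>, hence lie in \<open>Q\<close>, hence do not
  exist; and iterating \<open>\<phi>\<close> inside a \<open>g\<close>-invariant region loses walls until a fixed point is
  reached. So the fixed points correspond to the \<open>g\<close>-invariant regions of \<open>Q\<close>.

  If \<open>J = a I a\<^sup>-\<^sup>1\<close>, then \<open>u W\<^sub>J\<close> and \<open>u a W\<^sub>I\<close> have the same stabiliser, so the sums for \<open>I\<close>
  and \<open>J\<close> agree after the substitution \<open>u \<mapsto> u a\<close>, and the first claim follows
  (\<open>card_coset_reps_conj_class\<close>). The second follows by summing over the conjugacy classes in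
  \<open>C(\<lambda>)\<close>.
\<close>

section \<open>Conjugation and left cosets\<close>

context group begin

definition conjugate :: "'a \<Rightarrow> 'a \<Rightarrow> 'a" where
  "conjugate g x = g \<otimes> x \<otimes> inv g"

lemma conjugate_closed [simp, intro]: "g \<in> carrier G \<Longrightarrow> x \<in> carrier G \<Longrightarrow> conjugate g x \<in> carrier G"
  by (simp add: conjugate_def)

lemma conjugate_conjugate:
  "g \<in> carrier G \<Longrightarrow> h \<in> carrier G \<Longrightarrow> x \<in> carrier G \<Longrightarrow>
    conjugate g (conjugate h x) = conjugate (g \<otimes> h) x"
  by (simp add: conjugate_def inv_mult_group m_assoc)

lemma conjugate_one [simp]: "x \<in> carrier G \<Longrightarrow> conjugate \<one> x = x"
  by (simp add: conjugate_def)

lemma conjugate_mult: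
  assumes "g \<in> carrier G" "x \<in> carrier G" "y \<in> carrier G"
  shows "conjugate g (x \<otimes> y) = conjugate g x \<otimes> conjugate g y"
proof -
  have "inv g \<otimes> (g \<otimes> z) = z" if "z \<in> carrier G" for z
    using assms(1) that by (simp add: m_assoc[symmetric])
  then show ?thesis using assms by (simp add: conjugate_def m_assoc)
qed

lemma conjugate_inv_conjugate [simp]:
  "g \<in> carrier G \<Longrightarrow> x \<in> carrier G \<Longrightarrow> conjugate (inv g) (conjugate g x) = x"
  "g \<in> carrier G \<Longrightarrow> x \<in> carrier G \<Longrightarrow> conjugate g (conjugate (inv g) x) = x"
  by (simp_all add: conjugate_conjugate)

lemma conjugate_inj: "g \<in> carrier G \<Longrightarrow> inj_on (conjugate g) (carrier G)"
  by (metis inj_on_inverseI conjugate_inv_conjugate(1))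

lemma conjugate_image_closed: "g \<in> carrier G \<Longrightarrow> A \<subseteq> carrier G \<Longrightarrow> conjugate g ` A \<subseteq> carrier G"
  by auto

lemma conjugate_image_conjugate:
  "g \<in> carrier G \<Longrightarrow> h \<in> carrier G \<Longrightarrow> A \<subseteq> carrier G \<Longrightarrow>
    conjugate g ` conjugate h ` A = conjugate (g \<otimes> h) ` A"
  unfolding image_image by (rule image_cong) (auto simp: conjugate_conjugate subset_iff)

lemma conjugate_image_one: "A \<subseteq> carrier G \<Longrightarrow> conjugate \<one> ` A = A"
  by (force simp: subset_iff)

lemma conjugate_mem_image_iff:
  assumes "g \<in> carrier G" "A \<subseteq> carrier G" "x \<in> carrier G"
  shows "x \<in> conjugate g ` A \<longleftrightarrow> conjugate (inv g) x \<in> A"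
  using assms by (auto simp: image_iff subset_iff) (metis conjugate_inv_conjugate(2))

lemma conjugate_image_sym_diff:
  assumes "g \<in> carrier G" "A \<subseteq> carrier G" "B \<subseteq> carrier G"
  shows "conjugate g ` sym_diff A B = sym_diff (conjugate g ` A) (conjugate g ` B)"
proof -
  have "conjugate g ` (U - V) = conjugate g ` U - conjugate g ` V" if "U \<subseteq> carrier G" "V \<subseteq> carrier G" for U V
    using that assms(1) by (intro inj_on_image_set_diff[OF conjugate_inj]) auto
  then show ?thesis using assms by (simp add: image_Un)
qed

lemma card_conjugate_image: "g \<in> carrier G \<Longrightarrow> A \<subseteq> carrier G \<Longrightarrow> card (conjugate g ` A) = card A"
  by (meson card_image conjugate_inj inj_on_subset)

lemma conjugate_image_subgroup:
  assumes "subgroup H G" "h \<in> H"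
  shows "conjugate h ` H = H"
proof -
  have "H \<subseteq> carrier G" using assms by (simp add: subgroup.subset)
  have *: "conjugate k x \<in> H" if "k \<in> H" "x \<in> H" for k x
    using that assms(1) by (simp add: conjugate_def subgroup.m_closed subgroup.m_inv_closed)
  have "x \<in> conjugate h ` H" if "x \<in> H" for x
  proof -
    have "x = conjugate h (conjugate (inv h) x)" using that assms \<open>H \<subseteq> carrier G\<close> by (simp add: subset_iff)
    then show ?thesis using * that assms by (metis imageI subgroup.m_inv_closed)
  qed
  then show ?thesis using * assms by blast
qed

lemma generate_conjugate_image:
  assumes "g \<in> carrier G" "I \<subseteq> carrier G"
  shows "generate G (conjugate g ` I) = conjugate g ` generate G I"
proof -
  have "conjugate g \<in> hom G G"
    using assms(1) by (auto simp: hom_def conjugate_mult)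
  then have "group_hom G G (conjugate g)"
    by (simp add: group_hom_axioms_def group_hom_def is_group)
  then show ?thesis using assms(2) by (metis group_hom.generate_img)
qed

lemma left_coset_carrier:
  "u \<in> carrier G \<Longrightarrow> H \<subseteq> carrier G \<Longrightarrow> u <# H \<subseteq> carrier G"
  by (auto simp: l_coset_def)

lemma mem_left_coset_swap:
  assumes "subgroup H G" "x \<in> carrier G" "y \<in> carrier G" "y \<in> x <# H"
  shows "x \<in> y <# H"
proof -
  obtain h where h: "h \<in> H" "y = x \<otimes> h" using assms(4) by (auto simp: l_coset_def)
  have "h \<in> carrier G" using h assms(1) by (simp add: subgroup.mem_carrier)
  then have "x = y \<otimes> inv h" using h assms by (simp add: m_assoc)
  then show ?thesis using h assms(1) by (auto simp: l_coset_def subgroup.m_inv_closed)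
qed

lemma card_left_coset:
  assumes "u \<in> carrier G" "H \<subseteq> carrier G"
  shows "card (u <# H) = card H"
proof -
  have "u <# H = (\<lambda>h. u \<otimes> h) ` H" by (auto simp: l_coset_def)
  moreover have "inj_on (\<lambda>h. u \<otimes> h) H"
    using assms by (auto intro!: inj_onI simp: subset_iff)
  ultimately show ?thesis by (simp add: card_image)
qed

lemma conjugate_image_left_coset:
  assumes "subgroup H G" "u \<in> carrier G" "x \<in> u <# H"
  shows "conjugate x ` H = conjugate u ` H"
proof -
  obtain h where h: "h \<in> H" "x = u \<otimes> h" using assms(3) by (auto simp: l_coset_def)
  have H: "H \<subseteq> carrier G" using assms(1) by (rule subgroup.subset)
  have "conjugate x ` H = conjugate u ` conjugate h ` H"
    using h assms(2) H by (simp add: conjugate_image_conjugate subset_iff)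
  then show ?thesis using conjugate_image_subgroup[OF assms(1) h(1)] by simp
qed

end

section \<open>Words in the generators\<close>

context coxeter_system begin

lemma S_carrier [simp]: "s \<in> S \<Longrightarrow> s \<in> carrier W"
  using S_subset by auto

lemma S_square [simp]: "s \<in> S \<Longrightarrow> s \<otimes> s = \<one>"
  using pow_ord_eq_1[OF S_carrier, of s] S_order[of s] by (simp add: numeral_2_eq_2)

lemma S_inv [simp]: "s \<in> S \<Longrightarrow> inv s = s"
  by (rule inv_equality) simp_all

lemma S_cancel [simp]: "s \<in> S \<Longrightarrow> x \<in> carrier W \<Longrightarrow> s \<otimes> (s \<otimes> x) = x"
  by (metis S_carrier S_square l_one m_assoc)

lemma word_prod_Nil [simp]: "word_prod W [] = \<one>"
  by (simp add: word_prod_def)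

lemma word_prod_Cons [simp]: "word_prod W (s # ws) = s \<otimes> word_prod W ws"
  by (simp add: word_prod_def)

lemma word_prod_closed [simp]: "set ws \<subseteq> S \<Longrightarrow> word_prod W ws \<in> carrier W"
  by (induction ws) auto

lemma word_prod_append:
  "set us \<subseteq> S \<Longrightarrow> set vs \<subseteq> S \<Longrightarrow> word_prod W (us @ vs) = word_prod W us \<otimes> word_prod W vs"
  by (induction us) (auto simp: m_assoc)

lemma word_prod_rev: "set ws \<subseteq> S \<Longrightarrow> word_prod W (rev ws) = inv (word_prod W ws)"
  by (induction ws) (auto simp: word_prod_append inv_mult_group)

lemma word_prod_alternating:
  assumes "s \<in> S" "t \<in> S"
  shows "word_prod W (concat (replicate n [s, t])) = (s \<otimes> t) [^] n"
proof (induction n)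
  case (Suc n)
  have "(s \<otimes> t) [^] Suc n = (s \<otimes> t) \<otimes> (s \<otimes> t) [^] n"
    using assms by (intro nat_pow_Suc2) simp
  then show ?case using Suc assms by (simp add: m_assoc del: nat_pow_Suc)
qed simp

lemma generate_words:
  assumes "I \<subseteq> S"
  shows "w \<in> generate W I \<longleftrightarrow> (\<exists>ws. set ws \<subseteq> I \<and> word_prod W ws = w)"
proof
  assume "w \<in> generate W I"
  then show "\<exists>ws. set ws \<subseteq> I \<and> word_prod W ws = w"
  proof induction
    case one
    show ?case by (rule exI[of _ "[]"]) simp
  next
    case (incl s)
    then show ?case using assms by (intro exI[of _ "[s]"]) auto
  next
    case (inv s)
    then show ?case using assms by (intro exI[of _ "[s]"]) auto
  next
    case (eng x y)
    then obtain us vs where "set us \<subseteq> I" "word_prod W us = x" "set vs \<subseteq> I" "word_prod W vs = y"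
      by auto
    then show ?case using assms by (intro exI[of _ "us @ vs"]) (auto simp: word_prod_append)
  qed
next
  have "set ws \<subseteq> I \<Longrightarrow> word_prod W ws \<in> generate W I" for ws
    by (induction ws) (auto intro: generate.intros)
  then show "\<exists>ws. set ws \<subseteq> I \<and> word_prod W ws = w \<Longrightarrow> w \<in> generate W I" by auto
qed

lemma carrier_words: "w \<in> carrier W \<Longrightarrow> \<exists>ws. set ws \<subseteq> S \<and> word_prod W ws = w"
  using generate_words[OF order_refl, of w] generated by blast

section \<open>Inversion sets\<close>

text \<open>
  For a word \<open>s\<^sub>1 \<dots> s\<^sub>n\<close> these are the reflections that occur an odd number of times among
  \<open>(s\<^sub>1 \<dots> s\<^sub>i\<^sub>-\<^sub>1) s\<^sub>i (s\<^sub>1 \<dots> s\<^sub>i\<^sub>-\<^sub>1)\<^sup>-\<^sup>1\<close>. Parity makes the set invariant under the Coxeter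
  relations, so that it depends only on the product of the word.
\<close>

primrec word_inversions :: "'a list \<Rightarrow> 'a set" where
  "word_inversions [] = {}"
| "word_inversions (s # ws) = sym_diff {s} (conjugate s ` word_inversions ws)"

lemma word_inversions_closed: "set ws \<subseteq> S \<Longrightarrow> word_inversions ws \<subseteq> carrier W"
  by (induction ws) auto

lemma finite_word_inversions: "finite (word_inversions ws)"
  by (induction ws) auto

lemma word_inversions_append:
  assumes "set us \<subseteq> S" "set vs \<subseteq> S"
  shows "word_inversions (us @ vs) =
    sym_diff (word_inversions us) (conjugate (word_prod W us) ` word_inversions vs)"
  using assms
proof (induction us)
  case Nil
  then show ?case using word_inversions_closed[of vs] by (simp add: conjugate_image_one)
next
  case (Cons s us)
  then have "word_inversions ((s # us) @ vs) = sym_diff {s} (sym_diff (conjugate s ` word_inversions us)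
      (conjugate s ` conjugate (word_prod W us) ` word_inversions vs))"
    using word_inversions_closed[of vs] word_inversions_closed[of us]
    by (simp add: conjugate_image_sym_diff conjugate_image_closed)
  also have "\<dots> = sym_diff (word_inversions (s # us))
      (conjugate (word_prod W (s # us)) ` word_inversions vs)"
    using Cons.prems word_inversions_closed[of vs] by (simp add: conjugate_image_conjugate) blast
  finally show ?case .
qed

lemma conjugate_rotation_power:
  assumes "s \<in> S" "t \<in> S"
  shows "conjugate ((s \<otimes> t) [^] (n::nat)) ((s \<otimes> t) [^] (k::nat) \<otimes> s) = (s \<otimes> t) [^] (2 * n + k) \<otimes> s"
proof (induction n)
  case (Suc n)
  let ?r = "s \<otimes> t"
  have r: "?r \<in> carrier W" using assms by simp
  have flip: "s \<otimes> inv ?r = ?r \<otimes> s" using assms by (simp add: inv_mult_group m_assoc)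
  have step: "conjugate ?r (?r [^] j \<otimes> s) = ?r [^] Suc (Suc j) \<otimes> s" for j :: nat
  proof -
    have "conjugate ?r (?r [^] j \<otimes> s) = ?r \<otimes> ?r [^] j \<otimes> (s \<otimes> inv ?r)"
      unfolding conjugate_def using assms r by (simp only: m_assoc m_closed nat_pow_closed inv_closed S_carrier)
    also have "\<dots> = ?r [^] Suc j \<otimes> (?r \<otimes> s)"
      using flip r by (simp only: nat_pow_Suc2)
    also have "\<dots> = ?r [^] Suc (Suc j) \<otimes> s"
      using assms r by (simp only: nat_pow_Suc m_assoc m_closed nat_pow_closed S_carrier)
    finally show ?thesis .
  qed
  have "conjugate (?r [^] Suc n) (?r [^] k \<otimes> s) = conjugate ?r (conjugate (?r [^] n) (?r [^] k \<otimes> s))"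
    unfolding nat_pow_Suc2[OF r] using assms r by (subst conjugate_conjugate) simp_all
  then show ?case using Suc step by simp
qed (use assms in simp)

text \<open>
  The reflections met along the alternating word \<open>s t s t \<dots>\<close> of length \<open>2 n\<close> are the
  \<open>(s t)\<^sup>k s\<close> for \<open>k < 2 n\<close>.
\<close>

lemma mem_word_inversions_alternating:
  assumes "s \<in> S" "t \<in> S"
  shows "x \<in> word_inversions (concat (replicate n [s, t])) \<longleftrightarrow>
    odd (card {k. k < 2 * n \<and> (s \<otimes> t) [^] k \<otimes> s = x})"
proof (induction n)
  case (Suc n)
  let ?r = "s \<otimes> t"
  let ?K = "\<lambda>n. {k. k < n \<and> ?r [^] k \<otimes> s = x}"
  have split: "concat (replicate (Suc n) [s, t]) = concat (replicate n [s, t]) @ [s, t]"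
    by (induction n) simp_all
  have sub: "set (concat (replicate n [s, t])) \<subseteq> S" using assms by auto
  have K_Suc: "odd (card (?K (Suc m))) \<longleftrightarrow> (odd (card (?K m)) \<noteq> (x = ?r [^] m \<otimes> s))" for m
  proof -
    have "?K (Suc m) = (if x = ?r [^] m \<otimes> s then insert m (?K m) else ?K m)"
      by (auto simp: less_Suc_eq)
    then show ?thesis by simp
  qed
  have a: "conjugate (?r [^] n) s = ?r [^] (2 * n) \<otimes> s"
    using conjugate_rotation_power[OF assms, of n 0] assms by simp
  have b: "conjugate (?r [^] n) (conjugate s t) = ?r [^] Suc (2 * n) \<otimes> s"
    using conjugate_rotation_power[OF assms, of n 1] assms by (simp add: conjugate_def)
  have "conjugate (?r [^] n) ` word_inversions [s, t] =
      sym_diff {?r [^] (2 * n) \<otimes> s} {?r [^] Suc (2 * n) \<otimes> s}"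
    using a b assms conjugate_image_sym_diff[of "?r [^] n" "{s}" "{conjugate s t}"] by (simp del: nat_pow_Suc)
  then have "x \<in> conjugate (?r [^] n) ` word_inversions [s, t] \<longleftrightarrow>
      (x = ?r [^] (2 * n) \<otimes> s) \<noteq> (x = ?r [^] Suc (2 * n) \<otimes> s)"
    by auto
  then show ?case
    unfolding split word_inversions_append[OF sub, of "[s, t]", simplified assms]
    using Suc assms sub K_Suc[of "2 * n"] K_Suc[of "Suc (2 * n)"]
    by (simp add: word_inversions_append word_prod_alternating del: word_inversions.simps nat_pow_Suc) blast
qed simp

text \<open>
  The sequence \<open>(s t)\<^sup>k s\<close> has period \<open>m = ord (s t)\<close>, so every reflection along the relator, whose
  length is \<open>2 m\<close>, occurs an even number of times.
\<close>

lemma word_inversions_relator: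
  assumes "s \<in> S" "t \<in> S"
  shows "word_inversions (concat (replicate (ord (s \<otimes> t)) [s, t])) = {}"
proof -
  let ?r = "s \<otimes> t" and ?m = "ord (s \<otimes> t)"
  have r: "?r \<in> carrier W" using assms by simp
  have "x \<notin> word_inversions (concat (replicate ?m [s, t]))" for x
  proof -
    let ?K = "{k. k < ?m \<and> ?r [^] k \<otimes> s = x}"
    have per: "?r [^] (?m + k) = ?r [^] k" for k
      using r by (simp add: nat_pow_mult[symmetric] pow_ord_eq_1)
    have "{k. k < 2 * ?m \<and> ?r [^] k \<otimes> s = x} = ?K \<union> (+) ?m ` ?K"
    proof (intro equalityI subsetI)
      fix k assume k: "k \<in> {k. k < 2 * ?m \<and> ?r [^] k \<otimes> s = x}"
      show "k \<in> ?K \<union> (+) ?m ` ?K"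
      proof (cases "k < ?m")
        case False
        then obtain j where "k = ?m + j" using le_Suc_ex not_less by blast
        then show ?thesis using k per by auto
      qed (use k in auto)
    qed (auto simp: per)
    moreover have "card (?K \<union> (+) ?m ` ?K) = card ?K + card ?K"
      by (subst card_Un_disjoint) (auto simp: card_image)
    ultimately show ?thesis
      by (simp add: mem_word_inversions_alternating[OF assms])
  qed
  then show ?thesis by blast
qed

lemma coxeter_word_eq_word_inversions:
  "coxeter_word_eq W S us vs \<Longrightarrow> word_inversions us = word_inversions vs"
proof (induction rule: coxeter_word_eq.induct)
  case (relation us vs s t)
  let ?rel = "concat (replicate (ord (s \<otimes> t)) [s, t])"
  have rel: "set ?rel \<subseteq> S" using relation by auto
  have "word_prod W ?rel = \<one>"
    using relation by (simp add: word_prod_alternating pow_ord_eq_1)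
  then have "word_inversions (?rel @ vs) = word_inversions vs"
    using relation rel word_inversions_closed[of vs]
    by (simp add: word_inversions_append word_inversions_relator conjugate_image_one)
  then show ?case
    using relation rel by (simp add: word_inversions_append[of us])
qed auto

definition inversions :: "'a \<Rightarrow> 'a set" where
  "inversions w = word_inversions (SOME ws. set ws \<subseteq> S \<and> word_prod W ws = w)"

text \<open>
  Here the presentation of \<open>W\<close> enters: two words with the same product are joined by Coxeter
  relations, and these do not change the inversion set.
\<close>

lemma inversions_word:
  assumes "set ws \<subseteq> S"
  shows "inversions (word_prod W ws) = word_inversions ws"
proof -
  let ?vs = "SOME vs. set vs \<subseteq> S \<and> word_prod W vs = word_prod W ws"
  have "set ?vs \<subseteq> S \<and> word_prod W ?vs = word_prod W ws"
    by (rule someI[of _ ws]) (simp add: assms)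
  then show ?thesis
    unfolding inversions_def using coxeter_word_eq_word_inversions presentation assms by blast
qed

lemma inversions_closed: "w \<in> carrier W \<Longrightarrow> inversions w \<subseteq> carrier W"
  by (metis carrier_words inversions_word word_inversions_closed)

lemma finite_inversions: "w \<in> carrier W \<Longrightarrow> finite (inversions w)"
  by (metis carrier_words inversions_word finite_word_inversions)

lemma inversions_mult:
  assumes "x \<in> carrier W" "y \<in> carrier W"
  shows "inversions (x \<otimes> y) = sym_diff (inversions x) (conjugate x ` inversions y)"
proof -
  obtain us vs where "set us \<subseteq> S" "word_prod W us = x" "set vs \<subseteq> S" "word_prod W vs = y"
    using assms carrier_words by meson
  then show ?thesis
    using inversions_word[of "us @ vs"] inversions_word[of us] inversions_word[of vs]
    by (simp add: word_prod_append word_inversions_append)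
qed

lemma inversions_generator: "s \<in> S \<Longrightarrow> inversions s = {s}"
  using inversions_word[of "[s]"] by simp

lemma parabolic_subgroup: "I \<subseteq> S \<Longrightarrow> subgroup (generate W I) W"
  using S_subset by (intro generate_is_subgroup) auto

lemma inversions_parabolic:
  assumes "I \<subseteq> S" "w \<in> generate W I"
  shows "inversions w \<subseteq> generate W I"
proof -
  have "set ws \<subseteq> I \<Longrightarrow> word_inversions ws \<subseteq> generate W I" for ws
  proof (induction ws)
    case (Cons s ws)
    then have "s \<in> generate W I" by (auto intro: generate.incl)
    moreover have "conjugate s ` generate W I = generate W I"
      using assms(1) \<open>s \<in> generate W I\<close> by (simp add: conjugate_image_subgroup parabolic_subgroup)
    ultimately show ?case using Cons by auto
  qed simp
  moreover obtain ws where "set ws \<subseteq> I" "word_prod W ws = w"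
    using assms generate_words[OF assms(1), of w] by blast
  ultimately show ?thesis using inversions_word[of ws] assms(1) by auto
qed

text \<open>
  The strong exchange condition: multiplying by the reflection \<open>s\<^sub>1 \<dots> s\<^sub>i \<dots> s\<^sub>1\<close> deletes the letter
  \<open>s\<^sub>i\<close>. The letters of the new word are among the old ones, so the lemma can also be used inside
  a parabolic subgroup.
\<close>

lemma word_exchange:
  assumes "set ws \<subseteq> S" "t \<in> word_inversions ws"
  shows "\<exists>vs. set vs \<subseteq> set ws \<and> length vs < length ws \<and> word_prod W vs = t \<otimes> word_prod W ws"
  using assms
proof (induction ws arbitrary: t)
  case (Cons s ws)
  then have s: "s \<in> S" and ws: "set ws \<subseteq> S" by auto
  from Cons.prems consider "t = s" | t' where "t' \<in> word_inversions ws" "t = conjugate s t'"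
    by auto
  then show ?case
  proof cases
    case 1
    then show ?thesis using s ws by (intro exI[of _ ws]) auto
  next
    case 2
    then obtain vs where vs: "set vs \<subseteq> set ws" "length vs < length ws"
        "word_prod W vs = t' \<otimes> word_prod W ws"
      using Cons.IH ws by blast
    have t': "t' \<in> carrier W" using 2 word_inversions_closed[OF ws] by auto
    have "conjugate s t' \<otimes> (s \<otimes> x) = s \<otimes> (t' \<otimes> x)" if "x \<in> carrier W" for x
      using s t' that by (simp add: conjugate_def m_assoc)
    then have "word_prod W (s # vs) = t \<otimes> word_prod W (s # ws)"
      using vs ws 2 by simp
    then show ?thesis using vs by (intro exI[of _ "s # vs"]) auto
  qed
qed simp

text \<open>
  The first letter \<open>s\<close> of a shortest word for \<open>w \<noteq> \<one>\<close> in the letters \<open>I\<close> is an inversion of \<open>w\<close>: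
  otherwise it is met a second time along the word, and exchange yields a shorter word.
\<close>

lemma parabolic_no_simple_inversion:
  assumes "I \<subseteq> S" "w \<in> generate W I" "inversions w \<inter> I = {}"
  shows "w = \<one>"
proof -
  obtain ws0 where "set ws0 \<subseteq> I \<and> word_prod W ws0 = w"
    using assms(1,2) generate_words[of I w] by blast
  then obtain ws where ws: "set ws \<subseteq> I" "word_prod W ws = w"
    and least: "\<And>vs. set vs \<subseteq> I \<Longrightarrow> word_prod W vs = w \<Longrightarrow> length ws \<le> length vs"
    using ex_has_least_nat[of "\<lambda>ws. set ws \<subseteq> I \<and> word_prod W ws = w" ws0 length] by metis
  show ?thesis
  proof (cases ws)
    case (Cons s us)
    then have s: "s \<in> I" "s \<in> S" and us: "set us \<subseteq> I" "set us \<subseteq> S" using ws assms(1) by auto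
    have "inversions w = word_inversions (s # us)"
      using ws(2) s us Cons inversions_word[of "s # us"] by simp
    then have "s \<notin> word_inversions (s # us)"
      using assms(3) s by blast
    then obtain t where t: "t \<in> word_inversions us" "conjugate s t = s" by auto
    \<comment> \<open>The second occurrence of \<open>s\<close> comes from an inversion \<open>s\<close> of the remaining word.\<close>
    have "conjugate s t = conjugate s s" using t(2) s by (simp add: conjugate_def)
    then have "t = s"
      using t s word_inversions_closed[OF us(2)] inj_onD[OF conjugate_inj[of s], of t s]
      by (simp add: subset_iff)
    then obtain vs where vs: "set vs \<subseteq> set us" "length vs < length us"
        "word_prod W vs = s \<otimes> word_prod W us"
      using word_exchange[OF us(2)] t by blast
    have "length ws \<le> length vs"
    proof (rule least)
      show "set vs \<subseteq> I" using vs(1) us(1) by blast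
      show "word_prod W vs = w" using vs(3) ws(2) Cons by simp
    qed
    then show ?thesis using vs(2) Cons by simp
  qed (use ws in simp)
qed

abbreviation len :: "'a \<Rightarrow> nat" where "len \<equiv> coxeter_length W S"

lemma reduced_word:
  assumes "w \<in> carrier W"
  obtains ws where "set ws \<subseteq> S" "word_prod W ws = w" "length ws = len w"
proof -
  let ?P = "\<lambda>n. \<exists>ws. set ws \<subseteq> S \<and> word_prod W ws = w \<and> length ws = n"
  obtain ws where "set ws \<subseteq> S" "word_prod W ws = w"
    using carrier_words[OF assms] by blast
  then have "?P (length ws)" by blast
  then have "?P (len w)" unfolding coxeter_length_def by (rule LeastI[of ?P])
  then show ?thesis using that by blast
qed

lemma len_le:
  assumes "set ws \<subseteq> S" shows "len (word_prod W ws) \<le> length ws"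
  unfolding coxeter_length_def
  by (rule Least_le[of "\<lambda>n. \<exists>vs. set vs \<subseteq> S \<and> word_prod W vs = word_prod W ws \<and> length vs = n"])
    (use assms in blast)

lemma len_inv:
  assumes "w \<in> carrier W" shows "len (inv w) = len w"
proof -
  have *: "len (inv v) \<le> len v" if v: "v \<in> carrier W" for v
  proof -
    obtain vs where vs: "set vs \<subseteq> S" "word_prod W vs = v" "length vs = len v"
      using reduced_word[OF v] .
    have "len (word_prod W (rev vs)) \<le> length (rev vs)" by (rule len_le) (use vs in simp)
    then show ?thesis using vs by (simp add: word_prod_rev)
  qed
  show ?thesis using *[OF assms] *[of "inv w"] assms by simp
qed

lemma len_decreases:
  assumes "w \<in> carrier W" "t \<in> inversions w"
  shows "len (t \<otimes> w) < len w"
proof -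
  obtain ws where ws: "set ws \<subseteq> S" "word_prod W ws = w" "length ws = len w"
    using reduced_word[OF assms(1)] .
  then have "t \<in> word_inversions ws" using assms(2) inversions_word[of ws] by simp
  then obtain vs where vs: "set vs \<subseteq> set ws" "length vs < length ws"
      "word_prod W vs = t \<otimes> word_prod W ws"
    using word_exchange[OF ws(1)] by blast
  then have "len (word_prod W vs) \<le> length vs" using ws(1) by (intro len_le) blast
  then show ?thesis using vs ws by simp
qed

lemma len_generator_mult:
  assumes "s \<in> S" "w \<in> carrier W"
  shows "len w < len (s \<otimes> w) \<longleftrightarrow> s \<notin> inversions w"
proof
  assume "s \<notin> inversions w"
  moreover have "conjugate (inv s) s = s" using assms(1) by (simp add: conjugate_def)
  ultimately have "s \<notin> conjugate s ` inversions w"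
    using assms inversions_closed[OF assms(2)] by (subst conjugate_mem_image_iff) auto
  then have "s \<in> inversions (s \<otimes> w)"
    using assms by (simp add: inversions_mult inversions_generator)
  then show "len w < len (s \<otimes> w)" using len_decreases[of "s \<otimes> w" s] assms by simp
next
  assume "len w < len (s \<otimes> w)"
  then show "s \<notin> inversions w" using len_decreases[OF assms(2), of s] by auto
qed

section \<open>Minimal coset representatives\<close>

text \<open>
  An element of minimal length in \<open>W\<^sub>I v\<close> has no inversion in \<open>W\<^sub>I\<close>, since a reflection in \<open>W\<^sub>I\<close>
  that is an inversion would shorten it within the coset. This gives the projections to faces.
\<close>

lemma parabolic_coset_minimum:
  assumes "I \<subseteq> S" "v \<in> carrier W"
  obtains a where "a \<in> generate W I" "inversions (a \<otimes> v) \<inter> generate W I = {}"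
proof -
  note sub = parabolic_subgroup[OF assms(1)]
  obtain a where a: "a \<in> generate W I"
    and least: "\<And>b. b \<in> generate W I \<Longrightarrow> len (a \<otimes> v) \<le> len (b \<otimes> v)"
    using ex_has_least_nat[of "\<lambda>a. a \<in> generate W I" \<one> "\<lambda>a. len (a \<otimes> v)"]
    by (auto intro: generate.one)
  have ac: "a \<in> carrier W" using a sub subgroup.mem_carrier by metis
  have "t \<notin> inversions (a \<otimes> v)" if t: "t \<in> generate W I" for t
  proof
    assume "t \<in> inversions (a \<otimes> v)"
    moreover have "t \<in> carrier W" using t sub subgroup.mem_carrier by metis
    ultimately have "len (t \<otimes> a \<otimes> v) < len (a \<otimes> v)"
      using len_decreases[of "a \<otimes> v" t] ac assms by (simp add: m_assoc)
    then show False using least[of "t \<otimes> a"] t a sub by (simp add: generate.eng leD)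
  qed
  then show ?thesis using that a by blast
qed

text \<open>
  The definition of \<open>X\<^sub>I\<close> constrains only the simple reflections in \<open>I\<close>; the criterion here is about
  all of \<open>W\<^sub>I\<close>, and so can be moved to any coset of \<open>W\<^sub>I\<close> by translation. To pass from the former
  to the latter, write
  \<open>x\<^sup>-\<^sup>1 = a\<^sup>-\<^sup>1 y\<close> with \<open>a \<in> W\<^sub>I\<close> and \<open>y\<close> minimal in \<open>W\<^sub>I x\<^sup>-\<^sup>1\<close>. The inversions of
  \<open>x\<^sup>-\<^sup>1\<close> in \<open>W\<^sub>I\<close> are those of \<open>a\<^sup>-\<^sup>1\<close>; if none of them is simple, then \<open>a = \<one>\<close>.
\<close>

lemma coset_reps_iff:
  assumes "I \<subseteq> S"
  shows "x \<in> coset_reps W S I \<longleftrightarrow> x \<in> carrier W \<and> inversions (inv x) \<inter> generate W I = {}"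
proof (cases "x \<in> carrier W")
  case x: True
  note sub = parabolic_subgroup[OF assms]
  have "len x < len (x \<otimes> s) \<longleftrightarrow> s \<notin> inversions (inv x)" if "s \<in> I" for s
  proof -
    have "s \<in> S" using that assms by auto
    then show ?thesis using len_generator_mult[of s "inv x"] len_inv[of "x \<otimes> s"] len_inv[of x] x
      by (simp add: inv_mult_group)
  qed
  then have iff: "x \<in> coset_reps W S I \<longleftrightarrow> inversions (inv x) \<inter> I = {}"
    using x by (auto simp: coset_reps_def)
  have "inversions (inv x) \<inter> generate W I = {}" if simple: "inversions (inv x) \<inter> I = {}"
  proof -
    obtain a where a: "a \<in> generate W I" and min: "inversions (a \<otimes> inv x) \<inter> generate W I = {}"
      using parabolic_coset_minimum[OF assms, of "inv x"] x by auto
    have ac: "a \<in> carrier W" and ia: "inv a \<in> generate W I"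
      using a sub by (auto simp: subgroup.mem_carrier subgroup.m_inv_closed)
    let ?N = "inversions (a \<otimes> inv x)"
    have "inv a \<otimes> (a \<otimes> inv x) = inv x"
      using ac x by (subst m_assoc[symmetric]) simp_all
    then have "inversions (inv x) = sym_diff (inversions (inv a)) (conjugate (inv a) ` ?N)"
      using inversions_mult[of "inv a" "a \<otimes> inv x"] ac x by simp
    moreover have "conjugate (inv a) ` ?N \<inter> generate W I = {}"
    proof -
      have "conjugate (inv a) ` ?N \<inter> conjugate (inv a) ` generate W I =
          conjugate (inv a) ` (?N \<inter> generate W I)"
        using ac x inversions_closed[of "a \<otimes> inv x"] subgroup.subset[OF sub]
        by (intro inj_on_image_Int[OF conjugate_inj, symmetric]) simp_all
      then show ?thesis using min conjugate_image_subgroup[OF sub ia] by simp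
    qed
    ultimately have "inversions (inv a) \<inter> I = {}"
      using simple generate.incl[of _ I W] by blast
    then have "inv a = \<one>"
      using parabolic_no_simple_inversion[OF assms ia] by blast
    then have "a = \<one>" using ac inv_inv[of a] by simp
    then show ?thesis using min x by simp
  qed
  then show ?thesis using iff x generate.incl[of _ I W] by blast
qed (simp add: coset_reps_def)


section \<open>Walls and faces\<close>

definition separating :: "'a \<Rightarrow> 'a \<Rightarrow> 'a set" where
  "separating c d = sym_diff (inversions c) (inversions d)"

lemma separating_commute: "separating c d = separating d c"
  by (auto simp: separating_def)

lemma separating_disjoint_trans:
  "separating c d \<inter> Q = {} \<Longrightarrow> separating d e \<inter> Q = {} \<Longrightarrow> separating c e \<inter> Q = {}"
  by (auto simp: separating_def)

lemma separating_disjoint_iff: "separating c d \<inter> Q = {} \<longleftrightarrow> inversions c \<inter> Q = inversions d \<inter> Q"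
  by (auto simp: separating_def)

lemma separating_closed:
  "c \<in> carrier W \<Longrightarrow> d \<in> carrier W \<Longrightarrow> separating c d \<subseteq> carrier W"
  using inversions_closed by (auto simp: separating_def)

lemma finite_separating:
  "c \<in> carrier W \<Longrightarrow> d \<in> carrier W \<Longrightarrow> finite (separating c d)"
  by (simp add: finite_inversions separating_def)

lemma separating_translate:
  assumes "g \<in> carrier W" "c \<in> carrier W" "d \<in> carrier W"
  shows "separating (g \<otimes> c) (g \<otimes> d) = conjugate g ` separating c d"
proof -
  have "separating (g \<otimes> c) (g \<otimes> d) = sym_diff (conjugate g ` inversions c) (conjugate g ` inversions d)"
    unfolding separating_def inversions_mult[OF assms(1,2)] inversions_mult[OF assms(1,3)] by blast
  then show ?thesis
    unfolding separating_def using assms inversions_closed by (simp add: conjugate_image_sym_diff)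
qed

lemma separating_eq_inversions:
  assumes "c \<in> carrier W" "d \<in> carrier W"
  shows "separating c d = conjugate c ` inversions (inv c \<otimes> d)"
proof -
  have "c \<otimes> (inv c \<otimes> d) = d" using assms by (subst m_assoc[symmetric]) simp_all
  then have "inversions d = sym_diff (inversions c) (conjugate c ` inversions (inv c \<otimes> d))"
    using inversions_mult[of c "inv c \<otimes> d"] assms by simp
  then show ?thesis unfolding separating_def by blast
qed

lemma separating_empty:
  assumes "c \<in> carrier W" "d \<in> carrier W" "separating c d = {}"
  shows "c = d"
proof -
  have "inversions (inv c \<otimes> d) = {}"
    using separating_eq_inversions[OF assms(1,2)] assms(3) by simp
  then have "inv c \<otimes> d = \<one>"
    using parabolic_no_simple_inversion[of S "inv c \<otimes> d"] assms generated by simp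
  then have "c \<otimes> (inv c \<otimes> d) = c" using assms by simp
  moreover have "c \<otimes> (inv c \<otimes> d) = d" using assms by (subst m_assoc[symmetric]) simp_all
  ultimately show ?thesis by simp
qed

text \<open>
  The set \<open>F\<close> plays the role of the chambers around a face whose stabiliser is \<open>P\<close>. The two
  conditions say that chambers of \<open>F\<close> are separated only by walls through the face, and that
  every chamber has a projection to \<open>F\<close>, from which no wall through the face separates it. They
  mention neither \<open>I\<close> nor \<open>u\<close>, so that faces of different types with the same \<open>P\<close> can be compared.
\<close>

definition face :: "'a set \<Rightarrow> 'a set \<Rightarrow> bool" where
  "face P F \<longleftrightarrow> P \<subseteq> carrier W \<and> F \<subseteq> carrier W \<and>
    (\<forall>x\<in>F. \<forall>y\<in>F. separating x y \<subseteq> P) \<and>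
    (\<forall>c\<in>carrier W. \<exists>p\<in>F. separating c p \<inter> P = {})"

section \<open>Fixed points of projection followed by translation\<close>

text \<open>
  These are the chambers \<open>c\<close> whose projection to \<open>F\<close> is \<open>g c\<close>, in other words the fixed points of
  projection to \<open>F\<close> followed by translation by \<open>g\<^sup>-\<^sup>1\<close>.
\<close>

definition fixed_chambers :: "'a \<Rightarrow> 'a set \<Rightarrow> 'a set \<Rightarrow> 'a set" where
  "fixed_chambers g P F = {c \<in> carrier W. g \<otimes> c \<in> F \<and> separating c (g \<otimes> c) \<inter> P = {}}"

text \<open>
  When \<open>P\<close> is a subgroup of a finite group, this is the intersection of all \<open>g\<^sup>n P g\<^sup>-\<^sup>n\<close>. Written as
  a union of stable sets, it yields directly the maximality that is applied to sets of walls below.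
\<close>

definition stable_core :: "'a \<Rightarrow> 'a set \<Rightarrow> 'a set" where
  "stable_core g P = \<Union>{A. A \<subseteq> P \<and> conjugate g ` A = A}"

lemma stable_core_subset: "stable_core g P \<subseteq> P"
  unfolding stable_core_def by blast

lemma stable_core_greatest: "A \<subseteq> P \<Longrightarrow> conjugate g ` A = A \<Longrightarrow> A \<subseteq> stable_core g P"
  unfolding stable_core_def by blast

lemma stable_core_stable: "conjugate g ` stable_core g P = stable_core g P"
proof -
  have "conjugate g ` stable_core g P = \<Union>((`) (conjugate g) ` {A. A \<subseteq> P \<and> conjugate g ` A = A})"
    unfolding stable_core_def by (rule image_Union)
  also have "\<dots> = \<Union>((\<lambda>A. A) ` {A. A \<subseteq> P \<and> conjugate g ` A = A})"
    by (intro arg_cong[of _ _ Union] image_cong) auto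
  finally show ?thesis unfolding stable_core_def by simp
qed

lemma conjugate_image_inv:
  assumes "g \<in> carrier W" "A \<subseteq> carrier W" "conjugate g ` A = A"
  shows "conjugate (inv g) ` A = A"
proof -
  have "conjugate (inv g) ` A = conjugate (inv g) ` conjugate g ` A" using assms(3) by simp
  also have "\<dots> = A" using assms(1,2) by (simp add: conjugate_image_conjugate conjugate_image_one)
  finally show ?thesis .
qed

lemma separating_face_projections:
  assumes "face P F" "p \<in> F" "q \<in> F" "separating c p \<inter> P = {}" "separating d q \<inter> P = {}"
  shows "separating p q = separating c d \<inter> P"
proof -
  have "separating p q \<subseteq> P" using assms(1-3) unfolding face_def by blast
  moreover have "separating p q \<inter> P = separating c d \<inter> P"
    using assms(4,5) unfolding separating_def by blast
  ultimately show ?thesis by blast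
qed

text \<open>
  Let \<open>A\<close> be the set of walls between two fixed points \<open>c\<close> and \<open>d\<close>. Projection keeps the walls in
  \<open>P\<close>, so \<open>g A g\<^sup>-\<^sup>1 = A \<inter> P\<close>. The two sides have as many elements as \<open>A\<close> and \<open>A \<inter> P\<close>, which forces
  \<open>A \<subseteq> P\<close> and \<open>g A g\<^sup>-\<^sup>1 = A\<close>. So \<open>A\<close> is contained in the core and is empty as soon as no
  wall of the core separates \<open>c\<close> from \<open>d\<close>.
\<close>

lemma inj_on_fixed_chambers:
  assumes g: "g \<in> carrier W" and face: "face P F"
  shows "inj_on (\<lambda>d. inversions d \<inter> stable_core g P) (fixed_chambers g P F)"
proof (rule inj_onI)
  let ?Q = "stable_core g P"
  fix c d
  assume c: "c \<in> fixed_chambers g P F" and d: "d \<in> fixed_chambers g P F"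
    and "inversions c \<inter> ?Q = inversions d \<inter> ?Q"
  then have cd: "c \<in> carrier W" "d \<in> carrier W" and Q: "separating c d \<inter> ?Q = {}"
    by (auto simp: fixed_chambers_def separating_disjoint_iff)
  let ?A = "separating c d"
  note A = separating_closed[OF cd] finite_separating[OF cd]
  have img: "conjugate g ` ?A = ?A \<inter> P"
    using separating_face_projections[OF face, of "g \<otimes> c" "g \<otimes> d" c d] c d
      separating_translate[OF g cd] by (simp add: fixed_chambers_def)
  have "?A \<inter> P = ?A"
  proof (rule card_subset_eq)
    show "card (?A \<inter> P) = card ?A" using img card_conjugate_image[OF g A(1)] by simp
  qed (use A in auto)
  then have "?A \<subseteq> ?Q" using img by (intro stable_core_greatest) auto
  then show "c = d" using Q cd by (intro separating_empty) auto
qed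

text \<open>
  Let \<open>\<phi>\<close> be projection to \<open>F\<close> followed by translation by \<open>g\<^sup>-\<^sup>1\<close>. It preserves the region \<open>E\<close>
  of \<open>d\<close> with respect to the core, because \<open>g\<close> maps this region to itself. The
  number of walls between \<open>c\<close> and \<open>\<phi> c\<close> does not increase when \<open>c\<close> is replaced by \<open>\<phi> c\<close>, and only
  walls in \<open>P\<close> are kept; so if \<open>c\<close> minimises this number in \<open>E\<close>, all of them lie in \<open>P\<close>. The walls
  between \<open>c\<close> and \<open>\<phi> c\<close> for all minimising \<open>c\<close> form a \<open>g\<close>-stable subset of \<open>P\<close>, hence of the core;
  as \<open>c\<close> and \<open>\<phi> c\<close> lie in the same region, there are none and \<open>c\<close> is fixed.
\<close>

lemma fixed_chambers_surj:
  assumes g: "g \<in> carrier W" and face: "face P F" and d: "d \<in> carrier W"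
    and dQ: "separating d (g \<otimes> d) \<inter> stable_core g P = {}" and fin: "finite (carrier W)"
  shows "\<exists>c\<in>fixed_chambers g P F. separating d c \<inter> stable_core g P = {}"
proof -
  let ?Q = "stable_core g P"
  have PF: "P \<subseteq> carrier W" "F \<subseteq> carrier W" using face by (auto simp: face_def)
  have Qc: "?Q \<subseteq> carrier W" using PF stable_core_subset by blast
  note ig = inv_closed[OF g]
  have "\<forall>c\<in>carrier W. \<exists>p. p \<in> F \<and> separating c p \<inter> P = {}"
    using face unfolding face_def by blast
  then obtain proj where proj: "\<And>c. c \<in> carrier W \<Longrightarrow> proj c \<in> F"
      "\<And>c. c \<in> carrier W \<Longrightarrow> separating c (proj c) \<inter> P = {}"
    by metis
  have projc: "proj c \<in> carrier W" if "c \<in> carrier W" for c using proj(1)[OF that] PF by blast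
  define phi where "phi c = inv g \<otimes> proj c" for c
  have phic: "phi c \<in> carrier W" if "c \<in> carrier W" for c
    using projc[OF that] ig by (simp add: phi_def)
  have phi_sep: "separating (phi c) (phi d) = conjugate (inv g) ` (separating c d \<inter> P)"
    if "c \<in> carrier W" "d \<in> carrier W" for c d
    using separating_translate[OF ig projc[OF that(1)] projc[OF that(2)]]
      separating_face_projections[OF face proj(1)[OF that(1)] proj(1)[OF that(2)]
        proj(2)[OF that(1)] proj(2)[OF that(2)]]
    by (simp add: phi_def)
  have translate_Q: "separating (inv g \<otimes> x) (inv g \<otimes> y) \<inter> ?Q = {}"
    if "x \<in> carrier W" "y \<in> carrier W" "separating x y \<inter> ?Q = {}" for x y
  proof -
    have "conjugate (inv g) ` separating x y \<inter> conjugate (inv g) ` ?Q =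
        conjugate (inv g) ` (separating x y \<inter> ?Q)"
      using ig Qc separating_closed[OF that(1,2)]
      by (intro inj_on_image_Int[OF conjugate_inj, symmetric])
    then show ?thesis
      using that separating_translate[OF ig that(1,2)] conjugate_image_inv[OF g Qc stable_core_stable]
      by simp
  qed
  define E where "E = {c \<in> carrier W. separating d c \<inter> ?Q = {}}"
  have dE: "d \<in> E" using d by (simp add: E_def separating_def)
  have Ec: "c \<in> carrier W" if "c \<in> E" for c using that by (simp add: E_def)
  have phiE: "phi c \<in> E" if c: "c \<in> E" for c
  proof -
    have "separating c (proj c) \<inter> ?Q = {}"
      using proj(2)[OF Ec[OF c]] stable_core_subset[of g P] by blast
    then have "separating d (proj c) \<inter> ?Q = {}"
      using c separating_disjoint_trans unfolding E_def by blast
    then have 1: "separating (inv g \<otimes> d) (phi c) \<inter> ?Q = {}"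
      unfolding phi_def using d projc Ec c by (intro translate_Q) auto
    have 2: "separating (inv g \<otimes> d) (inv g \<otimes> (g \<otimes> d)) \<inter> ?Q = {}"
      using d g dQ by (intro translate_Q) auto
    have "inv g \<otimes> (g \<otimes> d) = d" using g d by (subst m_assoc[symmetric]) simp_all
    then have "separating d (inv g \<otimes> d) \<inter> ?Q = {}"
      using 2 by (subst separating_commute) simp
    then have "separating d (phi c) \<inter> ?Q = {}" using 1 by (rule separating_disjoint_trans)
    then show ?thesis using phic[OF Ec[OF c]] by (simp add: E_def)
  qed
  let ?m = "\<lambda>c. card (separating c (phi c))"
  obtain c0 where c0: "c0 \<in> E" and least: "\<And>c. c \<in> E \<Longrightarrow> ?m c0 \<le> ?m c"
    using ex_has_least_nat[of "\<lambda>c. c \<in> E" d ?m] dE by metis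
  define M where "M = {c \<in> E. ?m c = ?m c0}"
  define A where "A = (\<Union>c\<in>M. separating c (phi c))"
  \<comment> \<open>Projection keeps all walls between \<open>c\<close> and \<open>phi c\<close>, as their number is already minimal.\<close>
  have M: "separating c (phi c) \<subseteq> P \<and> phi c \<in> M \<and>
      separating (phi c) (phi (phi c)) = conjugate (inv g) ` separating c (phi c)" if "c \<in> M" for c
  proof -
    have c: "c \<in> E" "c \<in> carrier W" "?m c = ?m c0" using that Ec by (auto simp: M_def)
    let ?B = "separating c (phi c)"
    note B = separating_closed[OF c(2) phic[OF c(2)]] finite_separating[OF c(2) phic[OF c(2)]]
    have "?m (phi c) = card (?B \<inter> P)"
      using phi_sep[OF c(2) phic[OF c(2)]] B(1) card_conjugate_image[OF ig, of "?B \<inter> P"] by auto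
    moreover have "card (?B \<inter> P) \<le> card ?B" using B by (intro card_mono) auto
    moreover have "?m c0 \<le> ?m (phi c)" using least phiE c by blast
    ultimately have eq: "card (?B \<inter> P) = card ?B" "?m (phi c) = ?m c0" using c by auto
    then have "?B \<inter> P = ?B" using B by (intro card_subset_eq) auto
    then show ?thesis
      using phi_sep[OF c(2) phic[OF c(2)]] eq phiE c by (auto simp: M_def)
  qed
  have AP: "A \<subseteq> P" using M by (auto simp: A_def)
  then have Ac: "A \<subseteq> carrier W" using PF by blast
  \<comment> \<open>One inclusion suffices: \<open>A\<close> is finite and conjugation is injective.\<close>
  have "conjugate (inv g) ` A \<subseteq> A"
  proof -
    have "conjugate (inv g) ` separating c (phi c) \<subseteq> A" if "c \<in> M" for c
      using M[OF that] unfolding A_def by blast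
    then show ?thesis unfolding A_def by blast
  qed
  then have "conjugate (inv g) ` A = A"
    using card_conjugate_image[OF ig Ac] finite_subset[OF Ac fin] by (intro card_subset_eq) auto
  then have "conjugate g ` A = A" using conjugate_image_inv[OF ig Ac] g by simp
  then have AQ: "A \<subseteq> ?Q" using AP by (intro stable_core_greatest)
  have c0M: "c0 \<in> M" using c0 by (simp add: M_def)
  have "separating d c0 \<inter> ?Q = {}" "separating d (phi c0) \<inter> ?Q = {}"
    using c0 phiE by (auto simp: E_def)
  then have "separating c0 (phi c0) \<inter> ?Q = {}"
    by (simp add: separating_disjoint_iff)
  then have "separating c0 (phi c0) = {}" using AQ c0M unfolding A_def by blast
  then have "c0 = phi c0" using Ec[OF c0] phic by (intro separating_empty) auto
  then have "g \<otimes> c0 = g \<otimes> (inv g \<otimes> proj c0)" by (simp add: phi_def)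
  also have "\<dots> = proj c0"
    using g projc[OF Ec[OF c0]] by (subst m_assoc[symmetric]) simp_all
  finally have "c0 \<in> fixed_chambers g P F"
    using proj Ec[OF c0] by (simp add: fixed_chambers_def)
  then show ?thesis using c0 by (auto simp: E_def)
qed

text \<open>
  The face \<open>F\<close> does not occur on the right-hand side, which counts the regions of the core that \<open>g\<close>
  maps to themselves. A region is encoded by the walls of the core that separate it from \<open>\<one>\<close>.
\<close>

lemma card_fixed_chambers:
  assumes "g \<in> carrier W" "face P F" "finite (carrier W)"
  shows "card (fixed_chambers g P F) = card ((\<lambda>d. inversions d \<inter> stable_core g P) `
    {d \<in> carrier W. separating d (g \<otimes> d) \<inter> stable_core g P = {}})" (is "_ = card (?f ` ?D)")
proof -
  have "fixed_chambers g P F \<subseteq> ?D"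
    using stable_core_subset[of g P] unfolding fixed_chambers_def by blast
  moreover have "?f d \<in> ?f ` fixed_chambers g P F" if "d \<in> ?D" for d
    using fixed_chambers_surj[OF assms(1,2) _ _ assms(3), of d] that
    unfolding separating_disjoint_iff by blast
  ultimately have "?f ` fixed_chambers g P F = ?f ` ?D" by blast
  then show ?thesis
    using card_image[OF inj_on_fixed_chambers[OF assms(1,2)]] by simp
qed

section \<open>Parabolic cosets as faces\<close>

lemma face_parabolic_coset:
  assumes I: "I \<subseteq> S" and u: "u \<in> carrier W"
  shows "face (conjugate u ` generate W I) (u <# generate W I)"
proof -
  let ?H = "generate W I"
  note sub = parabolic_subgroup[OF I]
  have H: "?H \<subseteq> carrier W" using sub by (rule subgroup.subset)
  have coset: "conjugate x ` ?H = conjugate u ` ?H" if x: "x \<in> u <# ?H" for x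
    using conjugate_image_left_coset[OF sub u x] .
  have F: "u <# ?H \<subseteq> carrier W" using left_coset_carrier[OF u H] .
  have "separating x y \<subseteq> conjugate u ` ?H" if xy: "x \<in> u <# ?H" "y \<in> u <# ?H" for x y
  proof -
    obtain h k where hk: "h \<in> ?H" "x = u \<otimes> h" "k \<in> ?H" "y = u \<otimes> k"
      using xy by (auto simp: l_coset_def)
    then have c: "h \<in> carrier W" "k \<in> carrier W" using H by auto
    have "inv x \<otimes> y = inv h \<otimes> (inv u \<otimes> (u \<otimes> k))" using hk c u by (simp add: inv_mult_group m_assoc)
    also have "inv u \<otimes> (u \<otimes> k) = k" using c u by (subst m_assoc[symmetric]) simp_all
    finally have "inv x \<otimes> y \<in> ?H"
      using hk sub by (simp add: subgroup.m_closed subgroup.m_inv_closed)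
    then have "inversions (inv x \<otimes> y) \<subseteq> ?H" by (rule inversions_parabolic[OF I])
    then have "separating x y \<subseteq> conjugate x ` ?H"
      using separating_eq_inversions[of x y] F xy by (auto simp: subset_iff)
    then show ?thesis using coset[OF xy(1)] by simp
  qed
  moreover have "\<exists>p\<in>u <# ?H. separating c p \<inter> conjugate u ` ?H = {}" if c: "c \<in> carrier W" for c
  proof -
    obtain a where a: "a \<in> ?H" and min: "inversions (a \<otimes> (inv u \<otimes> c)) \<inter> ?H = {}"
      using parabolic_coset_minimum[OF I, of "inv u \<otimes> c"] c u by auto
    have ac: "a \<in> carrier W" using a H by auto
    \<comment> \<open>If \<open>a u\<^sup>-\<^sup>1 c\<close> is minimal in its coset, then \<open>p\<^sup>-\<^sup>1 c = a u\<^sup>-\<^sup>1 c\<close> for \<open>p = u a\<^sup>-\<^sup>1\<close>.\<close>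
    let ?p = "u \<otimes> inv a"
    have p: "?p \<in> u <# ?H" using a sub by (auto simp: l_coset_def subgroup.m_inv_closed)
    have pc: "?p \<in> carrier W" using u ac by simp
    have "inv ?p \<otimes> c = a \<otimes> (inv u \<otimes> c)" using u ac c by (simp add: inv_mult_group m_assoc)
    then have "separating ?p c = conjugate ?p ` inversions (a \<otimes> (inv u \<otimes> c))"
      using separating_eq_inversions[OF pc c] by simp
    moreover have "conjugate ?p ` inversions (a \<otimes> (inv u \<otimes> c)) \<inter> conjugate ?p ` ?H =
        conjugate ?p ` (inversions (a \<otimes> (inv u \<otimes> c)) \<inter> ?H)"
      using pc H inversions_closed[of "a \<otimes> (inv u \<otimes> c)"] ac u c
      by (intro inj_on_image_Int[OF conjugate_inj, symmetric]) simp_all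
    ultimately have "separating c ?p \<inter> conjugate ?p ` ?H = {}"
      using min separating_commute[of c ?p] by simp
    then show ?thesis using p coset[OF p] by auto
  qed
  ultimately show ?thesis unfolding face_def using F conjugate_image_closed[OF u H] by blast
qed


section \<open>Counting in a conjugacy class\<close>

text \<open>
  The inversions of \<open>(c\<^sup>-\<^sup>1 g c)\<^sup>-\<^sup>1 = (g c)\<^sup>-\<^sup>1 c\<close>, translated by \<open>g c\<close>, are the walls between \<open>g c\<close>
  and \<open>c\<close>.
\<close>

lemma conjugate_coset_reps_iff:
  assumes I: "I \<subseteq> S" and g: "g \<in> carrier W" and c: "c \<in> carrier W"
  shows "inv c \<otimes> g \<otimes> c \<in> coset_reps W S I \<longleftrightarrow>
    separating c (g \<otimes> c) \<inter> conjugate (g \<otimes> c) ` generate W I = {}"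
proof -
  let ?H = "generate W I" and ?x = "inv c \<otimes> g \<otimes> c"
  have H: "?H \<subseteq> carrier W" using parabolic_subgroup[OF I] by (rule subgroup.subset)
  have "inv ?x = inv (g \<otimes> c) \<otimes> c" using g c by (simp add: inv_mult_group m_assoc)
  then have "separating (g \<otimes> c) c = conjugate (g \<otimes> c) ` inversions (inv ?x)"
    using separating_eq_inversions[of "g \<otimes> c" c] g c by simp
  moreover have "conjugate (g \<otimes> c) ` inversions (inv ?x) \<inter> conjugate (g \<otimes> c) ` ?H =
      conjugate (g \<otimes> c) ` (inversions (inv ?x) \<inter> ?H)"
    using g c H inversions_closed[of "inv ?x"]
    by (intro inj_on_image_Int[OF conjugate_inj, symmetric]) simp_all
  ultimately have "separating c (g \<otimes> c) \<inter> conjugate (g \<otimes> c) ` ?H =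
      conjugate (g \<otimes> c) ` (inversions (inv ?x) \<inter> ?H)"
    by (subst separating_commute) simp
  then show ?thesis using g c coset_reps_iff[OF I, of ?x] by simp
qed

text \<open>
  Both sides count the pairs \<open>(u, c)\<close> with \<open>c\<^sup>-\<^sup>1 g c \<in> X\<^sub>I\<close> and \<open>g c \<in> u W\<^sub>I\<close>. Summing over elements
  \<open>u\<close> instead of cosets counts every coset \<open>|W\<^sub>I|\<close> times.
\<close>

lemma sum_card_fixed_chambers:
  assumes I: "I \<subseteq> S" and g: "g \<in> carrier W" and fin: "finite (carrier W)"
  shows "(\<Sum>u\<in>carrier W. card (fixed_chambers g (conjugate u ` generate W I) (u <# generate W I))) =
    card (generate W I) * card {c \<in> carrier W. inv c \<otimes> g \<otimes> c \<in> coset_reps W S I}"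
proof -
  let ?H = "generate W I" and ?A = "{c \<in> carrier W. inv c \<otimes> g \<otimes> c \<in> coset_reps W S I}"
  note sub = parabolic_subgroup[OF I]
  have H: "?H \<subseteq> carrier W" using sub by (rule subgroup.subset)
  have "fixed_chambers g (conjugate u ` ?H) (u <# ?H) = {c \<in> ?A. g \<otimes> c \<in> u <# ?H}"
    if u: "u \<in> carrier W" for u
  proof -
    have "inv c \<otimes> g \<otimes> c \<in> coset_reps W S I \<longleftrightarrow> separating c (g \<otimes> c) \<inter> conjugate u ` ?H = {}"
      if "c \<in> carrier W" "g \<otimes> c \<in> u <# ?H" for c
      using conjugate_coset_reps_iff[OF I g that(1)] conjugate_image_left_coset[OF sub u that(2)] by simp
    then show ?thesis unfolding fixed_chambers_def by blast
  qed
  then have "(\<Sum>u\<in>carrier W. card (fixed_chambers g (conjugate u ` ?H) (u <# ?H))) =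
      (\<Sum>u\<in>carrier W. card {c \<in> ?A. g \<otimes> c \<in> u <# ?H})"
    by (intro sum.cong) simp_all
  also have "\<dots> = card ?H * card ?A"
  proof (rule sum_multicount)
    show "\<forall>c\<in>?A. card {u \<in> carrier W. g \<otimes> c \<in> u <# ?H} = card ?H"
    proof
      fix c assume "c \<in> ?A"
      then have gc: "g \<otimes> c \<in> carrier W" using g by simp
      then have "{u \<in> carrier W. g \<otimes> c \<in> u <# ?H} = (g \<otimes> c) <# ?H"
        using left_coset_carrier[OF gc H] mem_left_coset_swap[OF sub] by blast
      then show "card {u \<in> carrier W. g \<otimes> c \<in> u <# ?H} = card ?H"
        using card_left_coset[OF gc H] by simp
    qed
  qed (use fin in auto)
  finally show ?thesis .
qed

text \<open>
  The elements that conjugate \<open>g\<close> to a given member of its class form a coset of the centraliser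
  of \<open>g\<close>.
\<close>

lemma card_conjugators:
  assumes g: "g \<in> carrier W" and fin: "finite (carrier W)"
  shows "card {c \<in> carrier W. inv c \<otimes> g \<otimes> c \<in> A} =
    card {z \<in> carrier W. z \<otimes> g = g \<otimes> z} * card (A \<inter> (\<lambda>c. inv c \<otimes> g \<otimes> c) ` carrier W)"
proof -
  let ?conj = "\<lambda>c. inv c \<otimes> g \<otimes> c"
  let ?Z = "{z \<in> carrier W. z \<otimes> g = g \<otimes> z}"
  let ?B = "{c \<in> carrier W. ?conj c \<in> A}" and ?XC = "A \<inter> ?conj ` carrier W"
  have fiber: "card {c \<in> ?B. ?conj c = x} = card ?Z" if x: "x \<in> ?XC" for x
  proof -
    obtain k where k: "k \<in> carrier W" "x = ?conj k" using x by auto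
    have iff: "?conj c = x \<longleftrightarrow> c \<otimes> inv k \<in> ?Z" if c: "c \<in> carrier W" for c
    proof -
      have "?conj c = x \<longleftrightarrow> c \<otimes> ?conj c \<otimes> inv k = c \<otimes> x \<otimes> inv k"
        using c k g by simp
      also have "c \<otimes> ?conj c \<otimes> inv k = g \<otimes> (c \<otimes> inv k)"
      proof -
        have "c \<otimes> ?conj c = g \<otimes> c" using c g by (simp add: m_assoc[symmetric])
        then show ?thesis using c k g by (simp add: m_assoc)
      qed
      also have "c \<otimes> x \<otimes> inv k = (c \<otimes> inv k) \<otimes> g"
        using c k g by (simp add: m_assoc)
      finally show ?thesis using c k by auto
    qed
    have "{c \<in> ?B. ?conj c = x} = {c \<in> carrier W. ?conj c = x}"
      using x by auto
    also have "\<dots> = {c \<in> carrier W. c \<otimes> inv k \<in> ?Z}"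
      by (intro Collect_cong conj_cong[OF HOL.refl] iff)
    also have "\<dots> = (\<lambda>z. z \<otimes> k) ` ?Z"
    proof (intro equalityI subsetI)
      fix c assume "c \<in> {c \<in> carrier W. c \<otimes> inv k \<in> ?Z}"
      then show "c \<in> (\<lambda>z. z \<otimes> k) ` ?Z"
        using k by (intro image_eqI[of _ _ "c \<otimes> inv k"]) (simp_all add: m_assoc)
    next
      fix c assume "c \<in> (\<lambda>z. z \<otimes> k) ` ?Z"
      then obtain z where z: "z \<in> ?Z" "c = z \<otimes> k" by blast
      then have "c \<otimes> inv k = z" using k by (simp add: m_assoc)
      then show "c \<in> {c \<in> carrier W. c \<otimes> inv k \<in> ?Z}" using z k by simp
    qed
    also have "card \<dots> = card ?Z"
      using k by (intro card_image inj_onI) simp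
    finally show ?thesis .
  qed
  have "(\<Sum>c\<in>?B. card {x \<in> ?XC. ?conj c = x}) = card ?Z * card ?XC"
    using fin fiber by (intro sum_multicount) auto
  moreover have "card {x \<in> ?XC. ?conj c = x} = 1" if "c \<in> ?B" for c
  proof -
    have "{x \<in> ?XC. ?conj c = x} = {?conj c}" using that by auto
    then show ?thesis by simp
  qed
  ultimately show ?thesis by simp
qed

lemma conj_class_eq:
  assumes "g \<in> carrier W"
  shows "conj_class W g = (\<lambda>c. inv c \<otimes> g \<otimes> c) ` carrier W"
proof -
  have "conj_class W g = (\<lambda>c. c \<otimes> g \<otimes> inv c) ` carrier W"
    using assms by (auto simp: conj_class_def orbit_def conj_action_def)
  also have "\<dots> = (\<lambda>c. inv c \<otimes> g \<otimes> c) ` carrier W"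
    by (force simp: image_iff intro: bexI[of _ "inv _"])
  finally show ?thesis .
qed

lemma conj_classes_eq: "conj_classes W = conj_class W ` carrier W"
  by (auto simp: conj_classes_def orbits_def conj_class_def)

text \<open>
  Since \<open>W\<^sub>J = a W\<^sub>I a\<^sup>-\<^sup>1\<close>, the faces \<open>u W\<^sub>J\<close> and \<open>u a W\<^sub>I\<close> have the same stabiliser
  \<open>u W\<^sub>J u\<^sup>-\<^sup>1\<close>, so they have equally many fixed chambers even where they are different faces.
\<close>

lemma card_coset_reps_conj_class:
  assumes fin: "finite (carrier W)" and I: "I \<subseteq> S" and J: "J \<subseteq> S"
    and a: "a \<in> carrier W" "conjugate a ` I = J" and C: "C \<in> conj_classes W"
  shows "card (coset_reps W S I \<inter> C) = card (coset_reps W S J \<inter> C)"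
proof -
  obtain g where g: "g \<in> carrier W" and Cg: "C = (\<lambda>c. inv c \<otimes> g \<otimes> c) ` carrier W"
    using C conj_class_eq by (auto simp: conj_classes_eq)
  let ?H = "generate W I" and ?K = "generate W J"
  let ?fix = "\<lambda>H u. card (fixed_chambers g (conjugate u ` H) (u <# H))"
  let ?Z = "{z \<in> carrier W. z \<otimes> g = g \<otimes> z}"
  have H: "?H \<subseteq> carrier W" using parabolic_subgroup[OF I] by (rule subgroup.subset)
  have K: "?K = conjugate a ` ?H" using generate_conjugate_image[OF a(1), of I] a(2) I S_subset by auto
  have count: "(\<Sum>u\<in>carrier W. ?fix (generate W L) u) =
      card (generate W L) * (card ?Z * card (coset_reps W S L \<inter> C))" if "L \<subseteq> S" for L
    using sum_card_fixed_chambers[OF that g fin] card_conjugators[OF g fin] Cg by simp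
  have "(\<Sum>u\<in>carrier W. ?fix ?K u) = (\<Sum>u\<in>carrier W. ?fix ?H (u \<otimes> a))"
  proof (rule sum.cong)
    fix u assume u: "u \<in> carrier W"
    then have P: "conjugate u ` ?K = conjugate (u \<otimes> a) ` ?H"
      unfolding K using a H by (simp add: conjugate_image_conjugate)
    have "face (conjugate u ` ?K) (u <# ?K)" using face_parabolic_coset[OF J u] .
    moreover have "face (conjugate u ` ?K) ((u \<otimes> a) <# ?H)"
      unfolding P using face_parabolic_coset[OF I] u a by simp
    ultimately show "?fix ?K u = ?fix ?H (u \<otimes> a)"
      unfolding P[symmetric] using card_fixed_chambers[OF g _ fin] by simp
  qed simp
  also have "\<dots> = (\<Sum>u\<in>carrier W. ?fix ?H u)"
  proof (rule sum.reindex_bij_betw)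
    show "bij_betw (\<lambda>u. u \<otimes> a) (carrier W) (carrier W)"
      using a(1) by (intro bij_betw_byWitness[of _ "\<lambda>u. u \<otimes> inv a"]) (auto simp: m_assoc)
  qed
  finally have "card ?K * (card ?Z * card (coset_reps W S J \<inter> C)) =
      card ?H * (card ?Z * card (coset_reps W S I \<inter> C))"
    using count[OF I] count[OF J] by simp
  moreover have "card ?K = card ?H" using K card_conjugate_image[OF a(1) H] by simp
  moreover have "card ?H \<noteq> 0"
    using finite_subset[OF H fin] generate.one[of W I] by auto
  moreover have "card ?Z \<noteq> 0"
    using fin g by (auto intro: exI[of _ "\<one>"])
  ultimately show ?thesis by simp
qed

section \<open>Unions of conjugacy classes\<close>

lemma conj_class_self: "w \<in> carrier W \<Longrightarrow> w \<in> conj_class W w"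
  by (auto simp: conj_class_eq image_iff intro!: bexI[of _ "\<one>"])

lemma conj_class_mem_eq:
  assumes "w \<in> carrier W" "v \<in> conj_class W w"
  shows "v \<in> carrier W \<and> conj_class W v = conj_class W w"
proof -
  obtain k where k: "k \<in> carrier W" "v = inv k \<otimes> w \<otimes> k"
    using assms conj_class_eq by auto
  then have v: "v \<in> carrier W" using assms by simp
  have "inv c \<otimes> v \<otimes> c = inv (k \<otimes> c) \<otimes> w \<otimes> (k \<otimes> c)" if "c \<in> carrier W" for c
    using that k assms by (simp add: inv_mult_group m_assoc)
  then have "(\<lambda>c. inv c \<otimes> v \<otimes> c) ` carrier W =
      (\<lambda>c. inv c \<otimes> w \<otimes> c) ` (\<lambda>c. k \<otimes> c) ` carrier W"
    unfolding image_image by (intro image_cong) simp_all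
  also have "(\<lambda>c. k \<otimes> c) ` carrier W = carrier W"
  proof (intro equalityI subsetI)
    fix x assume "x \<in> carrier W"
    then show "x \<in> (\<lambda>c. k \<otimes> c) ` carrier W"
      using k by (intro image_eqI[of _ _ "inv k \<otimes> x"]) (simp_all add: m_assoc[symmetric])
  qed (use k in auto)
  finally show ?thesis using v assms by (simp add: conj_class_eq)
qed

lemma card_Int_conj_closed:
  assumes fin: "finite (carrier W)" and E: "E \<subseteq> carrier W"
    and closed: "\<And>w. w \<in> E \<Longrightarrow> conj_class W w \<subseteq> E"
  shows "card (A \<inter> E) = (\<Sum>C\<in>conj_class W ` E. card (A \<inter> C))"
proof -
  have eq: "A \<inter> E = (\<Union>C\<in>conj_class W ` E. A \<inter> C)"
    using closed conj_class_self E by blast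
  have finE: "finite E" using E fin by (rule finite_subset)
  show ?thesis unfolding eq
  proof (rule card_UN_disjoint)
    show "\<forall>C\<in>conj_class W ` E. finite (A \<inter> C)"
      using closed finE by (auto intro: finite_subset)
    show "\<forall>C\<in>conj_class W ` E. \<forall>D\<in>conj_class W ` E. C \<noteq> D \<longrightarrow> (A \<inter> C) \<inter> (A \<inter> D) = {}"
    proof (intro ballI impI)
      fix C D assume "C \<in> conj_class W ` E" "D \<in> conj_class W ` E" "C \<noteq> D"
      then obtain v w where vw: "v \<in> E" "C = conj_class W v" "w \<in> E" "D = conj_class W w"
        by blast
      have "C = D" if "x \<in> C" "x \<in> D" for x
        using conj_class_mem_eq[of v x] conj_class_mem_eq[of w x] vw that E by auto
      then show "(A \<inter> C) \<inter> (A \<inter> D) = {}" using \<open>C \<noteq> D\<close> by blast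
    qed
  qed (use finE in simp)
qed

lemma class_elements_carrier: "class_elements W \<Lambda> \<subseteq> carrier W"
  by (auto simp: class_elements_def I_element_def)

text \<open>
  Being an \<open>I\<close>-element is defined through the conjugacy class only.
\<close>

lemma class_elements_conj_closed:
  assumes "w \<in> class_elements W \<Lambda>"
  shows "conj_class W w \<subseteq> class_elements W \<Lambda>"
proof
  fix v assume "v \<in> conj_class W w"
  then have "v \<in> carrier W \<and> conj_class W v = conj_class W w"
    using assms class_elements_carrier by (intro conj_class_mem_eq) auto
  then show "v \<in> class_elements W \<Lambda>"
    using assms by (auto simp: class_elements_def I_element_def)
qed

end

theorem proposition2p4:
  fixes W :: "('a, 'b) monoid_scheme" and S I J :: "'a set"
  assumes "coxeter_system W S"
    and "finite (carrier W)"
    and "I \<subseteq> S" and "J \<subseteq> S"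
    and "(I, J) \<in> coxeter_rel W S"
  shows "(\<forall>C\<in>conj_classes W. card (coset_reps W S I \<inter> C) = card (coset_reps W S J \<inter> C)) \<and>
    (\<forall>\<Lambda>\<in>coxeter_classes W S.
      card (coset_reps W S I \<inter> class_elements W \<Lambda>) =
      card (coset_reps W S J \<inter> class_elements W \<Lambda>))"
proof -
  interpret coxeter_system W S by (rule assms(1))
  obtain a where a: "a \<in> carrier W" "conjugate a ` I = J"
    using assms(5) by (auto simp: coxeter_rel_def conjugate_def)
  note classes = card_coset_reps_conj_class[OF assms(2-4) a]
  have "card (coset_reps W S I \<inter> class_elements W \<Lambda>) =
      card (coset_reps W S J \<inter> class_elements W \<Lambda>)" for \<Lambda>
  proof -
    let ?E = "class_elements W \<Lambda>"
    have split: "card (A \<inter> ?E) = (\<Sum>C\<in>conj_class W ` ?E. card (A \<inter> C))" for A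
      using assms(2) class_elements_carrier class_elements_conj_closed by (rule card_Int_conj_closed)
    have "conj_class W ` ?E \<subseteq> conj_classes W"
      unfolding conj_classes_eq using class_elements_carrier by (rule image_mono)
    then have "(\<Sum>C\<in>conj_class W ` ?E. card (coset_reps W S I \<inter> C)) =
        (\<Sum>C\<in>conj_class W ` ?E. card (coset_reps W S J \<inter> C))"
      by (intro sum.cong[OF HOL.refl] classes) blast
    then show ?thesis unfolding split .
  qed
  then show ?thesis using classes by blast
qed

end
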